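(* Let $G$ be a parity game and $\mathcal M=(M,<,\bot,\top,\upharpoonright,+)$ a regress measure space whose truncation operator is canonical. Let $\mu:V\to M$ be a quasi-dominion measure. Then $D_+(\mu)$ is a weak quasi 0-dominion, and every $\mu$-coherent 0-strategy that is winning on $D_0(\mu)$ is, once restricted to $D_+(\mu)$, a 0-witness for it.
   Context: Parity game: finite disjoint $V_0,V_1$ (positions of players 0,1), $V=V_0\cup V_1$, move relation $E\subseteq V\times V$ with $E(v)=\{w:(v,w)\in E\}\neq\emptyset$ for all $v$, priority function $p:V\to P$, $P\subset\mathbb{N}$ finite. A positional $\alpha$-strategy on $U\subseteq V$ is $\sigma:U\cap V_\alpha\to V$ with $(v,\sigma(v))\in E$ (a strategy without qualifier is one on $V$; restriction to $U$ restricts its domain to $U\cap V_\alpha$). For strategies $\sigma_0,\sigma_1$ on $U$ and $v\in U$, the play from $v$ in $U$ is the maximal finite or infinite sequence of positions of $U$ starting at $v$ whose successor at a $V_\alpha$ position is given by $\sigma_\alpha$. The priority of an infinite play is the maximal priority occurring infinitely often. $U$ is a 0-dominion if some 0-strategy on $U$ ensures that, for every 1-strategy on $U$ and $v\in U$, the play is infinite with even priority; a 0-strategy is winning on $U$ if its restriction to $U$ is such a strategy. $Q$ is a weak quasi 0-dominion if there is a 0-strategy on $Q$ (a 0-witness) such that for every 1-strategy on $Q$ and $v\in Q$, if the induced play in $Q$ is infinite its priority is even. A measure space is $(M,<,\bot,\top,\upharpoonright,+)$ with $<$ a strict total order on $M$ with minimum $\bot$ and maximum $\top$, truncation $\upharpoonright:M\times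 V\to M$ and stretch $+:M\times V\to M$. Truncation is canonical if $\eta=\top$ iff $\eta\upharpoonright_v=\top$, and $\eta\le\eta'$ implies $\eta\upharpoonright_v\le\eta'\upharpoonright_v$. Regress measure space: for all $\eta, v$: (1) $(\eta+v)\upharpoonright_v<\eta\upharpoonright_v$ if $\bot<\eta\upharpoonright_v<\top$ and $p(v)$ odd; (2) $(\eta+v)\upharpoonright_u\le\eta\upharpoonright_u$ for all odd-priority $u$ with $p(v)\le p(u)$. For $\mu:V\to M$: $D_0(\mu)=\{v:\mu(v)\upharpoonright_v=\top\}$, $D_\bot(\mu)=\{v:\mu(v)\upharpoonright_v=\bot\}$, $D_+(\mu)=V\setminus D_\bot(\mu)$. $\mu$ is a regress measure if for all $v\in D_+(\mu)\setminus D_0(\mu)$: if $v\in V_0$, $\mu(v)\le\mu(w)+v$ for some $w\in E(v)$; if $v\in V_1$, for all $w\in E(v)$. $\mu$ is a quasi-dominion measure if it is a regress measure and $D_0(\mu)$ is a 0-dominion. A 0-strategy $\sigma$ is $\mu$-coherent if $\mu(v)\le\mu(\sigma(v))+v$ for all $v\in V_0$. *)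

theory Defs
  imports Main "HOL-Library.FuncSet"
begin

record 'v parity_game =
  V0 :: "'v set"
  V1 :: "'v set"
  moves :: "('v \<times> 'v) set"
  prio :: "'v \<Rightarrow> nat"

definition positions :: "'v parity_game \<Rightarrow> 'v set" where
  "positions G = V0 G \<union> V1 G"

abbreviation succs :: "'v parity_game \<Rightarrow> 'v \<Rightarrow> 'v set" where
  "succs G v \<equiv> moves G `` {v}"

definition is_parity_game :: "'v parity_game \<Rightarrow> bool" where
  "is_parity_game G \<longleftrightarrow>
     finite (V0 G) \<and> finite (V1 G) \<and> V0 G \<inter> V1 G = {} \<and>
     moves G \<subseteq> positions G \<times> positions G \<and>
     (\<forall>v\<in>positions G. succs G v \<noteq> {})"

(* W is V0 G or V1 G. Note that a strategy on U may move out of U. *)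
definition strategies_for :: "'v parity_game \<Rightarrow> 'v set \<Rightarrow> 'v set \<Rightarrow> ('v \<Rightarrow> 'v) set" where
  "strategies_for G W U = (\<Pi>\<^sub>E v\<in>U \<inter> W. succs G v)"

abbreviation strategies0 :: "'v parity_game \<Rightarrow> 'v set \<Rightarrow> ('v \<Rightarrow> 'v) set" where
  "strategies0 G U \<equiv> strategies_for G (V0 G) U"

abbreviation strategies1 :: "'v parity_game \<Rightarrow> 'v set \<Rightarrow> ('v \<Rightarrow> 'v) set" where
  "strategies1 G U \<equiv> strategies_for G (V1 G) U"

definition restrict0 :: "'v parity_game \<Rightarrow> ('v \<Rightarrow> 'v) \<Rightarrow> 'v set \<Rightarrow> 'v \<Rightarrow> 'v" where
  "restrict0 G \<sigma> U = restrict \<sigma> (U \<inter> V0 G)"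

definition next_pos :: "'v parity_game \<Rightarrow> ('v \<Rightarrow> 'v) \<Rightarrow> ('v \<Rightarrow> 'v) \<Rightarrow> 'v \<Rightarrow> 'v" where
  "next_pos G \<sigma>0 \<sigma>1 v = (if v \<in> V0 G then \<sigma>0 v else \<sigma>1 v)"

(* A finite or infinite sequence is a function that is None from the end of the
   sequence on. The play in U ends as soon as its next position would lie outside U. *)
primrec play ::
  "'v parity_game \<Rightarrow> ('v \<Rightarrow> 'v) \<Rightarrow> ('v \<Rightarrow> 'v) \<Rightarrow> 'v set \<Rightarrow> 'v \<Rightarrow> nat \<Rightarrow> 'v option" where
  "play G \<sigma>0 \<sigma>1 U v 0 = (if v \<in> U then Some v else None)"
| "play G \<sigma>0 \<sigma>1 U v (Suc n) =
     (case play G \<sigma>0 \<sigma>1 U v n of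
        None \<Rightarrow> None
      | Some u \<Rightarrow> if next_pos G \<sigma>0 \<sigma>1 u \<in> U then Some (next_pos G \<sigma>0 \<sigma>1 u) else None)"

definition infinite_play :: "(nat \<Rightarrow> 'v option) \<Rightarrow> bool" where
  "infinite_play \<rho> \<longleftrightarrow> (\<forall>n. \<rho> n \<noteq> None)"

(* Meaningful for infinite plays only. *)
definition play_priority :: "'v parity_game \<Rightarrow> (nat \<Rightarrow> 'v option) \<Rightarrow> nat" where
  "play_priority G \<rho> = Max {k. \<exists>\<^sub>\<infinity>n. \<exists>v. \<rho> n = Some v \<and> prio G v = k}"

definition dominion0_strategy :: "'v parity_game \<Rightarrow> 'v set \<Rightarrow> ('v \<Rightarrow> 'v) \<Rightarrow> bool" where
  "dominion0_strategy G U \<sigma>0 \<longleftrightarrow>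
     \<sigma>0 \<in> strategies0 G U \<and>
     (\<forall>\<sigma>1\<in>strategies1 G U. \<forall>v\<in>U.
        infinite_play (play G \<sigma>0 \<sigma>1 U v) \<and>
        even (play_priority G (play G \<sigma>0 \<sigma>1 U v)))"

definition dominion0 :: "'v parity_game \<Rightarrow> 'v set \<Rightarrow> bool" where
  "dominion0 G U \<longleftrightarrow> U \<subseteq> positions G \<and> (\<exists>\<sigma>0. dominion0_strategy G U \<sigma>0)"

definition winning0_on :: "'v parity_game \<Rightarrow> 'v set \<Rightarrow> ('v \<Rightarrow> 'v) \<Rightarrow> bool" where
  "winning0_on G U \<sigma> \<longleftrightarrow> dominion0_strategy G U (restrict0 G \<sigma> U)"

definition witness0 :: "'v parity_game \<Rightarrow> 'v set \<Rightarrow> ('v \<Rightarrow> 'v) \<Rightarrow> bool" where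
  "witness0 G Q \<sigma>0 \<longleftrightarrow>
     \<sigma>0 \<in> strategies0 G Q \<and>
     (\<forall>\<sigma>1\<in>strategies1 G Q. \<forall>v\<in>Q.
        infinite_play (play G \<sigma>0 \<sigma>1 Q v) \<longrightarrow>
        even (play_priority G (play G \<sigma>0 \<sigma>1 Q v)))"

definition weak_quasi_dominion0 :: "'v parity_game \<Rightarrow> 'v set \<Rightarrow> bool" where
  "weak_quasi_dominion0 G Q \<longleftrightarrow> Q \<subseteq> positions G \<and> (\<exists>\<sigma>0. witness0 G Q \<sigma>0)"

(* The measures form a type, linearly ordered with least element bot and greatest
   element top; a measure space over it is given by its truncation tr and stretch st. *)

definition canonical_truncation ::
  "'v parity_game \<Rightarrow> ('m::{linorder,order_bot,order_top} \<Rightarrow> 'v \<Rightarrow> 'm) \<Rightarrow> bool" where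
  "canonical_truncation G tr \<longleftrightarrow>
     (\<forall>v\<in>positions G.
        (\<forall>\<eta>. \<eta> = top \<longleftrightarrow> tr \<eta> v = top) \<and>
        (\<forall>\<eta> \<eta>'. \<eta> \<le> \<eta>' \<longrightarrow> tr \<eta> v \<le> tr \<eta>' v))"

definition regress_measure_space ::
  "'v parity_game \<Rightarrow> ('m::{linorder,order_bot,order_top} \<Rightarrow> 'v \<Rightarrow> 'm) \<Rightarrow> ('m \<Rightarrow> 'v \<Rightarrow> 'm) \<Rightarrow> bool"
  where
  "regress_measure_space G tr st \<longleftrightarrow>
     (\<forall>\<eta>. \<forall>v\<in>positions G.
        (bot < tr \<eta> v \<and> tr \<eta> v < top \<and> odd (prio G v) \<longrightarrow> tr (st \<eta> v) v < tr \<eta> v) \<and>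
        (\<forall>u\<in>positions G. odd (prio G u) \<and> prio G v \<le> prio G u \<longrightarrow>
           tr (st \<eta> v) u \<le> tr \<eta> u))"

definition D_zero ::
  "'v parity_game \<Rightarrow> ('m::{linorder,order_bot,order_top} \<Rightarrow> 'v \<Rightarrow> 'm) \<Rightarrow> ('v \<Rightarrow> 'm) \<Rightarrow> 'v set" where
  "D_zero G tr \<mu> = {v \<in> positions G. tr (\<mu> v) v = top}"

definition D_bot ::
  "'v parity_game \<Rightarrow> ('m::{linorder,order_bot,order_top} \<Rightarrow> 'v \<Rightarrow> 'm) \<Rightarrow> ('v \<Rightarrow> 'm) \<Rightarrow> 'v set" where
  "D_bot G tr \<mu> = {v \<in> positions G. tr (\<mu> v) v = bot}"

definition D_plus ::
  "'v parity_game \<Rightarrow> ('m::{linorder,order_bot,order_top} \<Rightarrow> 'v \<Rightarrow> 'm) \<Rightarrow> ('v \<Rightarrow> 'm) \<Rightarrow> 'v set" where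
  "D_plus G tr \<mu> = positions G - D_bot G tr \<mu>"

definition regress_measure ::
  "'v parity_game \<Rightarrow> ('m::{linorder,order_bot,order_top} \<Rightarrow> 'v \<Rightarrow> 'm) \<Rightarrow> ('m \<Rightarrow> 'v \<Rightarrow> 'm)
     \<Rightarrow> ('v \<Rightarrow> 'm) \<Rightarrow> bool" where
  "regress_measure G tr st \<mu> \<longleftrightarrow>
     (\<forall>v\<in>D_plus G tr \<mu> - D_zero G tr \<mu>.
        (v \<in> V0 G \<longrightarrow> (\<exists>w\<in>succs G v. \<mu> v \<le> st (\<mu> w) v)) \<and>
        (v \<in> V1 G \<longrightarrow> (\<forall>w\<in>succs G v. \<mu> v \<le> st (\<mu> w) v)))"

definition quasi_dominion_measure ::
  "'v parity_game \<Rightarrow> ('m::{linorder,order_bot,order_top} \<Rightarrow> 'v \<Rightarrow> 'm) \<Rightarrow> ('m \<Rightarrow> 'v \<Rightarrow> 'm)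
     \<Rightarrow> ('v \<Rightarrow> 'm) \<Rightarrow> bool" where
  "quasi_dominion_measure G tr st \<mu> \<longleftrightarrow>
     regress_measure G tr st \<mu> \<and> dominion0 G (D_zero G tr \<mu>)"

definition coherent0 ::
  "'v parity_game \<Rightarrow> ('m::{linorder,order_bot,order_top} \<Rightarrow> 'v \<Rightarrow> 'm) \<Rightarrow> ('v \<Rightarrow> 'm)
     \<Rightarrow> ('v \<Rightarrow> 'v) \<Rightarrow> bool" where
  "coherent0 G st \<mu> \<sigma> \<longleftrightarrow> (\<forall>v\<in>V0 G. \<mu> v \<le> st (\<mu> (\<sigma> v)) v)"

end

theory Submission imports Defs "HOL-Library.Infinite_Set" begin

(* An infinite play inside D_plus that enters D_zero stays there, because sigma is winning on
   D_zero, so its priority is even. Suppose an infinite play x avoids D_zero and its priority is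
   odd, attained by a position u that recurs. Along x, mu (x n) <= mu (x (n+1)) + x n, so beyond
   the last visit to a larger priority the value of mu (x n) truncated at u is nondecreasing by
   the second regress condition, and each visit to u strictly increases it by the first. This contradicts the return to u. *)

lemma infinite_play_path:
  assumes "infinite_play (play G \<sigma>0 \<sigma>1 U v)"
  obtains x where "\<And>n. play G \<sigma>0 \<sigma>1 U v n = Some (x n)" "\<And>n. x n \<in> U"
    "\<And>n. x (Suc n) = next_pos G \<sigma>0 \<sigma>1 (x n)"
proof
  define x where "x n = the (play G \<sigma>0 \<sigma>1 U v n)" for n
  show x: "play G \<sigma>0 \<sigma>1 U v n = Some (x n)" for n
    using assms by (auto simp: infinite_play_def x_def)
  show "x n \<in> U" for n
    using x[of n] by (cases n) (auto split: if_splits option.splits)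
  show "x (Suc n) = next_pos G \<sigma>0 \<sigma>1 (x n)" for n
    using x[of "Suc n"] x[of n] by (auto split: if_splits)
qed

text \<open>Dropping the first \<open>N\<close> positions does not change which priorities occur
  infinitely often, so both maxima range over the same set.\<close>

lemma play_priority_shift:
  assumes "\<And>n. \<rho> n = Some (x n)" and "\<And>n. \<rho>' n = Some (x (N + n))"
  shows "play_priority G \<rho>' = play_priority G \<rho>"
proof -
  have "(\<exists>\<^sub>\<infinity>n. prio G (x (N + n)) = k) \<longleftrightarrow> (\<exists>\<^sub>\<infinity>n. prio G (x n) = k)" for k
    by (simp add: cofinite_eq_sequentially frequently_def add.commute[of N]
        eventually_sequentially_seg[of "\<lambda>n. prio G (x n) \<noteq> k"])
  then show ?thesis
    using assms by (simp add: play_priority_def)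
qed

text \<open>As \<open>U\<close> is finite, the play eventually visits only recurrent positions. The
  priorities occurring infinitely often are thus those of the finite nonempty set \<open>R\<close>,
  and their maximum is attained at some \<open>u\<close> in \<open>R\<close>.\<close>

lemma play_priority_recurrent:
  assumes "\<And>n. \<rho> n = Some (x n)" and "\<And>n. x n \<in> U" and "finite U"
  obtains u where "\<exists>\<^sub>\<infinity>n. x n = u" "play_priority G \<rho> = prio G u"
    "\<forall>\<^sub>\<infinity>n. prio G (x n) \<le> prio G u"
proof -
  define R where "R = {u \<in> U. \<exists>\<^sub>\<infinity>n. x n = u}"
  \<comment> \<open>Each position outside \<open>R\<close> is visited only finitely often, and
    finitely many such bounds combine into one.\<close>
  have "\<forall>\<^sub>\<infinity>n. \<forall>u\<in>U - R. x n \<noteq> u"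
    using assms(3) by (intro eventually_ball_finite) (auto simp: R_def not_frequently)
  then have ev: "\<forall>\<^sub>\<infinity>n. x n \<in> R"
    by eventually_elim (use assms(2) in blast)
  have "finite R"
    using assms(3) by (simp add: R_def)
  have "{k. \<exists>\<^sub>\<infinity>n. \<exists>v. \<rho> n = Some v \<and> prio G v = k} = prio G ` R"
  proof (intro set_eqI iffI)
    fix k assume "k \<in> {k. \<exists>\<^sub>\<infinity>n. \<exists>v. \<rho> n = Some v \<and> prio G v = k}"
    then have "\<exists>\<^sub>\<infinity>n. prio G (x n) = k"
      using assms(1) by simp
    then have "\<exists>\<^sub>\<infinity>n. prio G (x n) = k \<and> x n \<in> R"
      using ev by (rule INFM_conjI)
    then show "k \<in> prio G ` R"
      by (auto dest: INFM_EX)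
  next
    fix k assume "k \<in> prio G ` R"
    then obtain u where "k = prio G u" "\<exists>\<^sub>\<infinity>n. x n = u"
      by (auto simp: R_def)
    then show "k \<in> {k. \<exists>\<^sub>\<infinity>n. \<exists>v. \<rho> n = Some v \<and> prio G v = k}"
      using assms(1) by (auto elim: INFM_mono)
  qed
  then have pp: "play_priority G \<rho> = Max (prio G ` R)"
    by (simp add: play_priority_def)
  have "R \<noteq> {}"
    using ev by auto
  then have "Max (prio G ` R) \<in> prio G ` R"
    using \<open>finite R\<close> by simp
  then obtain u where u: "u \<in> R" "prio G u = Max (prio G ` R)"
    by auto
  have "\<forall>\<^sub>\<infinity>n. prio G (x n) \<le> prio G u"
    using ev by eventually_elim (use u \<open>finite R\<close> in simp)
  then show thesis
    using that u pp by (auto simp: R_def)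
qed

text \<open>This is the case of a play that never meets \<open>D_zero\<close>. Only the inequality
  between consecutive positions enters, so the positions of both players are treated alike.\<close>

lemma regress_path_even:
  fixes tr st :: "'m::{linorder,order_bot,order_top} \<Rightarrow> 'v \<Rightarrow> 'm"
  assumes "finite (positions G)"
    and space: "regress_measure_space G tr st"
    and canon: "canonical_truncation G tr"
    and x: "\<And>n. \<rho> n = Some (x n)" "\<And>n. x n \<in> D_plus G tr \<mu> - D_zero G tr \<mu>"
    and regress: "\<And>n. \<mu> (x n) \<le> st (\<mu> (x (Suc n))) (x n)"
  shows "even (play_priority G \<rho>)"
proof (rule ccontr)
  assume odd: "odd (play_priority G \<rho>)"
  have pos: "x n \<in> positions G" for n
    using x(2) by (auto simp: D_plus_def)
  obtain u where u: "\<exists>\<^sub>\<infinity>n. x n = u" "play_priority G \<rho> = prio G u"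
    "\<forall>\<^sub>\<infinity>n. prio G (x n) \<le> prio G u"
    using play_priority_recurrent[of \<rho> x "positions G"] x(1) pos assms(1) by metis
  obtain N where N: "\<And>n. n \<ge> N \<Longrightarrow> prio G (x n) \<le> prio G u"
    using u(3) unfolding MOST_nat_le by metis
  obtain i where i: "i \<ge> N" "x i = u"
    using u(1) unfolding INFM_nat_le by metis
  \<comment> \<open>The return must come strictly after \<open>i\<close>, so that the strict gain in
    the step from \<open>i\<close> to \<open>Suc i\<close> lies between the two visits.\<close>
  obtain j where j: "j \<ge> Suc i" "x j = u"
    using u(1) unfolding INFM_nat_le by metis
  have "u \<in> positions G"
    using pos i(2) by auto
  have mono: "tr (\<mu> (x n)) u \<le> tr (st (\<mu> (x (Suc n))) (x n)) u" for n
    using canon regress \<open>u \<in> positions G\<close> by (auto simp: canonical_truncation_def)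
  have "tr (st (\<mu> (x (Suc n))) (x n)) u \<le> tr (\<mu> (x (Suc n))) u" if "n \<ge> N" for n
    using space pos \<open>u \<in> positions G\<close> N[OF that] odd u(2)
    by (auto simp: regress_measure_space_def)
  then have step: "tr (\<mu> (x n)) u \<le> tr (\<mu> (x (Suc n))) u" if "n \<ge> N" for n
    using mono order_trans that by blast
  \<comment> \<open>The first regress condition will be applied to the measure of the successor
    \<open>x (Suc i)\<close>, stretched by \<open>u\<close>. Its truncation at \<open>u\<close> must
    therefore lie strictly between \<open>bot\<close> and \<open>top\<close>; the lower bound is
    inherited from \<open>u\<close> itself.\<close>
  have "bot < tr (\<mu> u) u"
    using x(2)[of i] i(2) by (auto simp: D_plus_def D_bot_def bot.not_eq_extremum)
  also have "\<dots> \<le> tr (\<mu> (x (Suc i))) u"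
    using step i by blast
  finally have "bot < tr (\<mu> (x (Suc i))) u" .
  \<comment> \<open>Lying outside \<open>D_zero\<close> concerns truncation at
    \<open>x (Suc i)\<close>. Canonicity turns this into the measure itself not being
    \<open>top\<close>, and hence into the same for truncation at \<open>u\<close>.\<close>
  moreover have "tr (\<mu> (x (Suc i))) (x (Suc i)) \<noteq> top"
    using x(2)[of "Suc i"] pos by (simp add: D_zero_def)
  then have "tr (\<mu> (x (Suc i))) u \<noteq> top"
    using pos[of "Suc i"] canon \<open>u \<in> positions G\<close> unfolding canonical_truncation_def by metis
  then have "tr (\<mu> (x (Suc i))) u < top"
    by (simp only: top.not_eq_extremum)
  ultimately have "tr (st (\<mu> (x (Suc i))) u) u < tr (\<mu> (x (Suc i))) u"
    using space \<open>u \<in> positions G\<close> odd u(2) by (auto simp: regress_measure_space_def)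
  then have "tr (\<mu> u) u < tr (\<mu> (x (Suc i))) u"
    using mono[of i] i(2) by simp
  also have "\<dots> \<le> tr (\<mu> (x j)) u"
    using j(1) by (induction rule: dec_induct) (use step i(1) in \<open>auto intro: order_trans\<close>)
  finally show False
    using j(2) by simp
qed

text \<open>From \<open>x N\<close> on, the sequence coincides with a play in \<open>D\<close>
  against the restriction of \<open>\<sigma>1\<close>. That play is infinite because
  \<open>\<sigma>0\<close> is winning on \<open>D\<close>, and its priority is that of the whole
  sequence.\<close>

lemma winning_suffix_even:
  assumes win: "winning0_on G D \<sigma>0" and "D \<subseteq> Q" and "Q \<subseteq> positions G"
    and s1: "\<sigma>1 \<in> strategies1 G Q"
    and x: "\<And>n. \<rho> n = Some (x n)" "\<And>n. x (Suc n) = next_pos G \<sigma>0 \<sigma>1 (x n)" "x N \<in> D"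
  shows "even (play_priority G \<rho>)"
proof -
  let ?\<tau> = "restrict \<sigma>1 (D \<inter> V1 G)"
  let ?\<rho> = "play G (restrict0 G \<sigma>0 D) ?\<tau> D (x N)"
  have "?\<tau> \<in> strategies1 G D"
    using s1 \<open>D \<subseteq> Q\<close> unfolding strategies_for_def by (auto simp: PiE_iff)
  then have inf: "infinite_play ?\<rho>" and ev: "even (play_priority G ?\<rho>)"
    using win x(3) by (auto simp: winning0_on_def dominion0_strategy_def)
  have "?\<rho> n = Some (x (N + n)) \<and> x (N + n) \<in> D" for n
  proof (induction n)
    case 0
    then show ?case using x(3) by simp
  next
    case (Suc n)
    \<comment> \<open>Inside \<open>D\<close> the restrictions agree with the original strategies; a
      position outside \<open>V0 G\<close> belongs to \<open>V1 G\<close> because \<open>D\<close>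
      consists of positions.\<close>
    have "next_pos G (restrict0 G \<sigma>0 D) ?\<tau> (x (N + n)) = x (N + Suc n)"
      using Suc.IH x(2) assms(2,3) by (auto simp: next_pos_def restrict0_def positions_def)
    then have "?\<rho> (Suc n) = (if x (N + Suc n) \<in> D then Some (x (N + Suc n)) else None)"
      using Suc.IH by (simp del: restrict_apply)
    \<comment> \<open>Infinity of the play in \<open>D\<close> rules out the branch in which the
      next position leaves \<open>D\<close>.\<close>
    moreover have "?\<rho> (Suc n) \<noteq> None"
      using inf unfolding infinite_play_def by blast
    ultimately show ?case
      by (metis (full_types))
  qed
  then show ?thesis
    using ev play_priority_shift[of \<rho> x ?\<rho> N] x(1) by simp
qed

text \<open>Common core of both claims of the theorem. The inequality is required only on
  \<open>D_plus\<close> minus \<open>D_zero\<close>, so the lemma serves coherent strategies as well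
  as a strategy glued from two pieces.\<close>

lemma regress_strategy_witness:
  fixes tr st :: "'m::{linorder,order_bot,order_top} \<Rightarrow> 'v \<Rightarrow> 'm"
  assumes "is_parity_game G"
    and "regress_measure_space G tr st" and "canonical_truncation G tr"
    and reg: "regress_measure G tr st \<mu>"
    and sub: "D_zero G tr \<mu> \<subseteq> D_plus G tr \<mu>"
    and s0: "\<sigma>0 \<in> strategies0 G (D_plus G tr \<mu>)"
    and win: "winning0_on G (D_zero G tr \<mu>) \<sigma>0"
    and coh: "\<And>v. v \<in> V0 G \<Longrightarrow> v \<in> D_plus G tr \<mu> - D_zero G tr \<mu> \<Longrightarrow> \<mu> v \<le> st (\<mu> (\<sigma>0 v)) v"
  shows "witness0 G (D_plus G tr \<mu>) \<sigma>0"
  unfolding witness0_def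
proof (intro conjI ballI impI)
  let ?Q = "D_plus G tr \<mu>"
  fix \<sigma>1 v
  assume s1: "\<sigma>1 \<in> strategies1 G ?Q" and "infinite_play (play G \<sigma>0 \<sigma>1 ?Q v)"
  then obtain x where x: "\<And>n. play G \<sigma>0 \<sigma>1 ?Q v n = Some (x n)" "\<And>n. x n \<in> ?Q"
    "\<And>n. x (Suc n) = next_pos G \<sigma>0 \<sigma>1 (x n)"
    using infinite_play_path by metis
  have Q: "?Q \<subseteq> positions G"
    by (auto simp: D_plus_def)
  show "even (play_priority G (play G \<sigma>0 \<sigma>1 ?Q v))"
  proof (cases "\<exists>N. x N \<in> D_zero G tr \<mu>")
    case True
    then show ?thesis
      using winning_suffix_even[OF win sub Q s1, of "play G \<sigma>0 \<sigma>1 ?Q v" x] x by blast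
  next
    case False
    then have D: "x n \<in> ?Q - D_zero G tr \<mu>" for n
      using x(2) by blast
    \<comment> \<open>Positions of player 0 use \<open>coh\<close>; at those of player 1 the regress
      condition covers every move, in particular the one chosen by \<open>\<sigma>1\<close>.\<close>
    have "\<mu> (x n) \<le> st (\<mu> (x (Suc n))) (x n)" for n
    proof (cases "x n \<in> V0 G")
      case True
      then show ?thesis using coh[OF True D] x(3) by (simp add: next_pos_def)
    next
      case False
      then have "x n \<in> V1 G" using x(2) Q by (auto simp: positions_def)
      moreover have "\<sigma>1 (x n) \<in> succs G (x n)"
        using s1 x(2) \<open>x n \<in> V1 G\<close> unfolding strategies_for_def by blast
      ultimately show ?thesis
        using reg D[of n] x(3) False unfolding regress_measure_def by (auto simp: next_pos_def)
    qed
    then show ?thesis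
      using regress_path_even[of G tr st "play G \<sigma>0 \<sigma>1 ?Q v" x \<mu>] assms(1-3) x(1) D
      by (auto simp: is_parity_game_def positions_def)
  qed
qed (rule s0)

lemma restrict0_strategies0:
  assumes "\<sigma> \<in> strategies0 G U" and "U' \<subseteq> U"
  shows "restrict0 G \<sigma> U' \<in> strategies0 G U'"
  using assms unfolding strategies_for_def restrict0_def by (auto simp: PiE_iff)

lemma restrict0_restrict0:
  assumes "U' \<subseteq> U"
  shows "restrict0 G (restrict0 G \<sigma> U) U' = restrict0 G \<sigma> U'"
  using assms by (auto simp: restrict0_def fun_eq_iff)

text \<open>The type classes admit \<open>bot = top\<close>. Then there is only one measure and
  every position is in \<open>D_bot\<close>; otherwise a truncation equal to \<open>top\<close>
  differs from \<open>bot\<close>.\<close>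

lemma D_plus_eq_empty_or_D_zero_subset:
  fixes tr :: "'m::{linorder,order_bot,order_top} \<Rightarrow> 'v \<Rightarrow> 'm"
  shows "D_plus G tr \<mu> = {} \<or> D_zero G tr \<mu> \<subseteq> D_plus G tr \<mu>"
proof (cases "(bot :: 'm) = top")
  case True
  then have "\<eta> = bot" for \<eta> :: 'm
    by (metis bot.extremum_uniqueI top_greatest)
  then show ?thesis by (auto simp: D_plus_def D_bot_def)
next
  case False
  then show ?thesis by (auto simp: D_plus_def D_zero_def D_bot_def)
qed

text \<open>\<open>coherent0\<close> speaks of all of \<open>V0 G\<close>, whereas a regress measure
  supplies suitable moves only on \<open>D_plus\<close> minus \<open>D_zero\<close>. The witness
  therefore follows a winning strategy \<open>\<tau>\<close> on \<open>D_zero\<close> and the moves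
  \<open>f\<close> on the rest of \<open>D_plus\<close>.\<close>

lemma exists_witness0_D_plus:
  fixes tr st :: "'m::{linorder,order_bot,order_top} \<Rightarrow> 'v \<Rightarrow> 'm"
  assumes "is_parity_game G"
    and "regress_measure_space G tr st" and "canonical_truncation G tr"
    and "quasi_dominion_measure G tr st \<mu>"
    and sub: "D_zero G tr \<mu> \<subseteq> D_plus G tr \<mu>"
  shows "\<exists>\<sigma>. witness0 G (D_plus G tr \<mu>) \<sigma>"
proof -
  let ?Q = "D_plus G tr \<mu>" and ?D = "D_zero G tr \<mu>"
  have reg: "regress_measure G tr st \<mu>"
    using assms(4) by (simp add: quasi_dominion_measure_def)
  obtain \<tau> where \<tau>: "dominion0_strategy G ?D \<tau>"
    using assms(4) by (auto simp: quasi_dominion_measure_def dominion0_def)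
  have \<tau>_in: "\<tau> \<in> strategies0 G ?D"
    using \<tau> by (simp add: dominion0_strategy_def)
  have "\<forall>v\<in>(?Q - ?D) \<inter> V0 G. \<exists>w. w \<in> succs G v \<and> \<mu> v \<le> st (\<mu> w) v"
    using reg by (auto simp: regress_measure_def)
  then obtain f where f: "\<And>v. v \<in> (?Q - ?D) \<inter> V0 G \<Longrightarrow> f v \<in> succs G v \<and> \<mu> v \<le> st (\<mu> (f v)) v"
    by metis
  define \<sigma> where "\<sigma> = restrict0 G (\<lambda>v. if v \<in> ?D then \<tau> v else f v) ?Q"
  have "\<sigma> \<in> strategies0 G ?Q"
    using \<tau>_in f unfolding strategies_for_def \<sigma>_def restrict0_def by (auto simp: PiE_iff)
  \<comment> \<open>Equality of functions also holds outside \<open>?D \<inter> V0 G\<close>, where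
    both sides are \<open>undefined\<close> by extensionality.\<close>
  moreover have "restrict0 G \<sigma> ?D = \<tau>"
  proof
    fix v
    show "restrict0 G \<sigma> ?D v = \<tau> v"
      using \<tau>_in sub unfolding strategies_for_def \<sigma>_def restrict0_def
      by (cases "v \<in> ?D \<inter> V0 G") (auto simp: PiE_iff extensional_def)
  qed
  then have "winning0_on G ?D \<sigma>"
    using \<tau> by (simp add: winning0_on_def)
  moreover have "\<mu> v \<le> st (\<mu> (\<sigma> v)) v" if "v \<in> V0 G" "v \<in> ?Q - ?D" for v
    using f[of v] that by (auto simp: \<sigma>_def restrict0_def)
  ultimately show ?thesis
    using regress_strategy_witness[OF assms(1-3) reg sub] by blast
qed

theorem theorem14:
  fixes G :: "'v parity_game"
    and tr st :: "'m::{linorder,order_bot,order_top} \<Rightarrow> 'v \<Rightarrow> 'm"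
    and \<mu> :: "'v \<Rightarrow> 'm"
  assumes "is_parity_game G"
    and "regress_measure_space G tr st"
    and "canonical_truncation G tr"
    and "quasi_dominion_measure G tr st \<mu>"
  shows "weak_quasi_dominion0 G (D_plus G tr \<mu>) \<and>
    (\<forall>\<sigma>\<in>strategies0 G (positions G).
       coherent0 G st \<mu> \<sigma> \<and> winning0_on G (D_zero G tr \<mu>) \<sigma> \<longrightarrow>
       witness0 G (D_plus G tr \<mu>) (restrict0 G \<sigma> (D_plus G tr \<mu>)))"
proof (cases "D_plus G tr \<mu> = {}")
  \<comment> \<open>Both claims are trivial for an empty \<open>D_plus\<close>, the only case in
    which \<open>D_zero\<close> may fail to be contained in it.\<close>
  case True
  then show ?thesis
    by (auto simp: weak_quasi_dominion0_def witness0_def strategies_for_def restrict0_def)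
next
  case False
  let ?Q = "D_plus G tr \<mu>" and ?D = "D_zero G tr \<mu>"
  have sub: "?D \<subseteq> ?Q"
    using False D_plus_eq_empty_or_D_zero_subset[of G tr \<mu>] by blast
  have Q: "?Q \<subseteq> positions G"
    by (auto simp: D_plus_def)
  have reg: "regress_measure G tr st \<mu>"
    using assms(4) by (simp add: quasi_dominion_measure_def)
  have "witness0 G ?Q (restrict0 G \<sigma> ?Q)"
    if \<sigma>: "\<sigma> \<in> strategies0 G (positions G)" "coherent0 G st \<mu> \<sigma>" "winning0_on G ?D \<sigma>" for \<sigma>
  proof (rule regress_strategy_witness[OF assms(1-3) reg sub])
    show "restrict0 G \<sigma> ?Q \<in> strategies0 G ?Q"
      using \<sigma>(1) Q by (rule restrict0_strategies0)
    show "winning0_on G ?D (restrict0 G \<sigma> ?Q)"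
      using \<sigma>(3) restrict0_restrict0[OF sub] by (simp add: winning0_on_def)
    show "\<mu> v \<le> st (\<mu> (restrict0 G \<sigma> ?Q v)) v" if "v \<in> V0 G" "v \<in> ?Q - ?D" for v
      using \<sigma>(2) that by (auto simp: coherent0_def restrict0_def)
  qed
  then show ?thesis
    using exists_witness0_D_plus[OF assms sub] Q by (auto simp: weak_quasi_dominion0_def)
qed

end
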